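(* For every $s>0$ there exists a separable metric space $X$ with $\dim_H X\ge s$ such that there is no uniformly continuous function from $X$ onto a non-degenerate closed interval of $\mathbb{R}$. (This is proved in ZFC.)
   Context: $\dim_H$ denotes Hausdorff dimension. *)

theory Defs
  imports "HOL-Analysis.Analysis"
begin

definition mdiam :: "'a metric \<Rightarrow> 'a set \<Rightarrow> real" where
  "mdiam m S = (if S = {} then 0 else (SUP x\<in>S. SUP y\<in>S. mdist m x y))"

definition hausdorff_pre :: "'a metric \<Rightarrow> real \<Rightarrow> real \<Rightarrow> 'a set \<Rightarrow> ennreal" where
  "hausdorff_pre m t \<delta> S =
     (INF U \<in> {U :: nat \<Rightarrow> 'a set. S \<subseteq> (\<Union>n. U n) \<and>
                 (\<forall>n. U n \<subseteq> mspace m \<and> (\<forall>x\<in>U n. \<forall>y\<in>U n. mdist m x y \<le> \<delta>))}.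
        (\<Sum>n. ennreal (mdiam m (U n) powr t)))"

definition hausdorff_measure :: "'a metric \<Rightarrow> real \<Rightarrow> 'a set \<Rightarrow> ennreal" where
  "hausdorff_measure m t S = (SUP \<delta>\<in>{0<..}. hausdorff_pre m t \<delta> S)"

text \<open>Hausdorff dimension of a metric space: \<open>inf {t > 0. H^t(X) = 0}\<close>
  (= \<open>\<infinity>\<close> if that set is empty).  Restricting to t > 0 avoids the
  convention issue for \<open>0 powr 0\<close>; it does not change the value.\<close>
definition hausdorff_dim :: "'a metric \<Rightarrow> ereal" where
  "hausdorff_dim m = Inf (ereal ` {t. t > 0 \<and> hausdorff_measure m t (mspace m) = 0})"

end

theory Submission
  imports Defs
begin

text \<open>
  On sequences of naturals use the ultrametric \<open>(k + 1) powr (- 1 / s)\<close>, where \<open>k\<close> is the first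
  index of disagreement. A set \<open>X\<close> of sequences has dimension at least \<open>s\<close> as soon as every
  sequence \<open>g\<close> differs everywhere from some \<open>x \<in> X\<close>: the sets of a cheap cover, ranked by
  diameter, are constant at the coordinate given by their rank, so the cover would yield a \<open>g\<close> that
  meets every point of \<open>X\<close>.

  If such an \<open>X\<close> exists with fewer than continuum many points, it has no image containing an
  interval. Otherwise any fewer than continuum many sequences are all met by one sequence \<open>g\<close>;
  by an argument of Bartoszynski, fewer than continuum many closed nowhere dense sets then do not
  cover the Baire space. In this case \<open>X\<close> is built by a transfinite recursion that diagonalises over
  all uniformly continuous functions: for each one a value \<open>y\<close> is chosen and its closed fibre is
  kept disjoint from \<open>X\<close>. The points of \<open>X\<close> have to be found in the closed sets
  \<open>{x. \<forall>n. x n \<noteq> g n}\<close>. For each finite prefix, any two of these sets meet, so only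
  one value \<open>y\<close> per prefix, hence only countably many in total, has a fibre with nonempty interior
  relative to one of them.
\<close>

subsection \<open>Guessing fewer than continuum many sequences\<close>

definition below_continuum :: "'a set \<Rightarrow> bool" where
  "below_continuum A \<longleftrightarrow> \<not> (UNIV :: real set) \<lesssim> A"

lemma below_continuum_iff_ordLess:
  "below_continuum A \<longleftrightarrow> ordLess2 (card_of A) (card_of (UNIV :: real set))"
  unfolding below_continuum_def lepoll_def by (rule card_of_ordLess)

lemma below_continuum_lepoll:
  "\<lbrakk>below_continuum A; B \<lesssim> A\<rbrakk> \<Longrightarrow> below_continuum B"
  unfolding below_continuum_def by (meson lepoll_trans)

lemma below_continuum_image: "below_continuum A \<Longrightarrow> below_continuum (f ` A)"
  by (erule below_continuum_lepoll) (rule image_lepoll)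

lemma countable_below_continuum: "countable A \<Longrightarrow> below_continuum A"
  unfolding below_continuum_def
  using countable_lepoll uncountable_UNIV_real by blast

lemma below_continuum_Un:
  "\<lbrakk>below_continuum A; below_continuum B\<rbrakk> \<Longrightarrow> below_continuum (A \<union> B)"
  unfolding below_continuum_iff_ordLess
  by (rule card_of_Un_ordLess_infinite) (auto simp: infinite_UNIV_char_0)

lemma below_continuum_Times_nat:
  assumes "below_continuum A"
  shows "below_continuum (A \<times> (UNIV :: nat set))"
proof (cases "finite A")
  case True
  then show ?thesis
    by (intro countable_below_continuum countable_SIGMA) (auto simp: countable_finite)
next
  case False
  then have "ordIso2 (card_of (A \<times> (UNIV :: nat set))) (card_of A)"
    by (intro conjunct1[OF card_of_Times_infinite]) (auto simp: infinite_iff_card_of_nat)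
  then have "A \<times> (UNIV :: nat set) \<approx> A"
    by (simp add: eqpoll_iff_card_of_ordIso)
  then show ?thesis
    using assms below_continuum_lepoll eqpoll_imp_lepoll by blast
qed

lemma closed_interval_not_below_continuum:
  fixes a b :: real
  assumes "a < b"
  shows "\<not> below_continuum {a..b}"
  unfolding below_continuum_def
  using closed_interval_eqpoll_reals[of a b] assms eqpoll_imp_lepoll eqpoll_sym by blast

lemma sets_of_countable_lepoll_real: "(A :: 'a::countable set set) \<lesssim> (UNIV :: real set)"
proof -
  have "inj_on (image to_nat) A"
    by (intro inj_onI) (simp add: inj_image_eq_iff)
  then have "A \<lesssim> (UNIV :: nat set set)"
    unfolding lepoll_def by blast
  then show ?thesis
    using nat_sets_eqpoll_reals eqpoll_imp_lepoll lepoll_trans by blast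
qed

lemma fun_nat_lepoll_real: "(UNIV :: (nat \<Rightarrow> nat) set) \<lesssim> (UNIV :: real set)"
proof -
  have "inj (\<lambda>x::nat \<Rightarrow> nat. {(n, x n) |n. True})"
    by (rule injI) (auto simp: set_eq_iff fun_eq_iff)
  then have "(UNIV :: (nat \<Rightarrow> nat) set) \<lesssim> (UNIV :: (nat \<times> nat) set set)"
    unfolding lepoll_def by blast
  then show ?thesis
    using sets_of_countable_lepoll_real lepoll_trans by blast
qed

text \<open>Equivalently, the Baire space is not covered by fewer than continuum many meagre sets.\<close>
definition guessing :: bool where
  "guessing \<longleftrightarrow> (\<forall>F :: (nat \<Rightarrow> nat) set. below_continuum F \<longrightarrow> (\<exists>g. \<forall>f\<in>F. \<exists>n. f n = g n))"

section \<open>Stronger forms of guessing\<close>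

lemma guess_countable:
  fixes f :: "'i \<Rightarrow> nat \<Rightarrow> 'v::countable"
  assumes guessing "below_continuum J"
  obtains g where "\<And>j. j \<in> J \<Longrightarrow> \<exists>n. f j n = g n"
proof -
  have "below_continuum ((\<lambda>j. to_nat \<circ> f j) ` J)"
    using assms(2) by (rule below_continuum_image)
  then obtain g where g: "\<forall>h\<in>(\<lambda>j. to_nat \<circ> f j) ` J. \<exists>n. h n = g n"
    using assms(1) unfolding guessing_def by blast
  show thesis
  proof
    fix j assume "j \<in> J"
    with g obtain n where "to_nat (f j n) = g n" by auto
    then show "\<exists>n. f j n = (from_nat \<circ> g) n"
      by (metis comp_apply from_nat_to_nat)
  qed
qed

text \<open>A greedy choice: at stage \<open>n\<close> at most \<open>n\<close> values have been
  used, so a set with more than \<open>n\<close> elements offers a fresh one. At other stages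
  \<open>k n\<close> is arbitrary, but later choices avoid it as well.\<close>

lemma exists_choice_injective:
  fixes S :: "nat \<Rightarrow> 'a set"
  obtains k where "\<And>n. finite (S n) \<Longrightarrow> n < card (S n) \<Longrightarrow> k n \<in> S n \<and> k n \<notin> k ` {..<n}"
proof -
  have "\<exists>k. \<forall>n. finite (S n) \<and> n < card (S n) \<longrightarrow> k n \<in> S n \<and> k n \<notin> k ` {..<n}"
  proof (rule dependent_wf_choice[OF wf_less_than,
        where P = "\<lambda>k n r. finite (S n) \<and> n < card (S n) \<longrightarrow> r \<in> S n \<and> r \<notin> k ` {..<n}"])
    fix f g :: "nat \<Rightarrow> 'a" and n r
    assume "\<And>z. (z, n) \<in> less_than \<Longrightarrow> f z = g z"
    then have "f ` {..<n} = g ` {..<n}" by (intro image_cong) auto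
    then show "(finite (S n) \<and> n < card (S n) \<longrightarrow> r \<in> S n \<and> r \<notin> f ` {..<n}) =
               (finite (S n) \<and> n < card (S n) \<longrightarrow> r \<in> S n \<and> r \<notin> g ` {..<n})" by simp
  next
    fix n and f :: "nat \<Rightarrow> 'a"
    show "\<exists>r. finite (S n) \<and> n < card (S n) \<longrightarrow> r \<in> S n \<and> r \<notin> f ` {..<n}"
    proof (cases "n < card (S n)")
      case True
      have "card (f ` {..<n}) \<le> n" using card_image_le[of "{..<n}" f] by simp
      with True have "\<not> S n \<subseteq> f ` {..<n}"
        using card_mono[of "f ` {..<n}" "S n"] by auto
      then show ?thesis by blast
    qed auto
  qed
  then show thesis using that by blast
qed

text \<open>Guess the graph of \<open>f j\<close> on the first \<open>n + 1\<close> points of \<open>X j\<close>; the \<open>n\<close>-th guess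
  can then fix the value of \<open>g\<close> at a point not used by the earlier guesses.\<close>
lemma guess_on_infinite_sets:
  fixes f :: "'i \<Rightarrow> nat \<Rightarrow> 'v::countable" and X :: "'i \<Rightarrow> nat set"
  assumes guessing "below_continuum J" and X: "\<And>j. j \<in> J \<Longrightarrow> infinite (X j)"
  obtains g where "\<And>j. j \<in> J \<Longrightarrow> \<exists>n\<in>X j. f j n = g n"
proof -
  define F where "F j n = map (\<lambda>i. (enumerate (X j) i, f j (enumerate (X j) i))) [0..<Suc n]" for j n
  obtain G where G: "\<And>j. j \<in> J \<Longrightarrow> \<exists>n. F j n = G n"
    using guess_countable[OF assms(1,2), of F] by blast
  define S where "S n = fst ` set (G n)" for n
  obtain k where k: "\<And>n. finite (S n) \<Longrightarrow> n < card (S n) \<Longrightarrow> k n \<in> S n \<and> k n \<notin> k ` {..<n}"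
    by (rule exists_choice_injective[of S]) blast
  \<comment> \<open>\<open>N\<close> inverts \<open>k\<close> on the stages with a large
    \<open>S n\<close>: there the later of two choices avoids the earlier one, so the description is
    unique.\<close>
  define N where "N m = (THE n. n < card (S n) \<and> k n = m)" for m
  have fin: "finite (S n)" for n by (simp add: S_def)
  have N: "N (k n) = n" if "n < card (S n)" for n
    unfolding N_def
  proof (rule the_equality)
    fix n' assume n': "n' < card (S n') \<and> k n' = k n"
    show "n' = n"
      using k[OF fin that] k[OF fin conjunct1[OF n']] n'
      by (metis imageI lessThan_iff linorder_neqE_nat)
  qed (use that in auto)
  define g where "g m = (THE v. (m, v) \<in> set (G (N m)))" for m
  show thesis
  proof
    fix j assume j: "j \<in> J"
    then obtain n where n: "F j n = G n" using G by blast
    have Sn: "S n = enumerate (X j) ` {..n}"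
      unfolding S_def n[symmetric] F_def
      by (simp add: image_image atLeast0LessThan lessThan_Suc_atMost del: upt_Suc)
    have "inj (enumerate (X j))"
      using X[OF j] by (simp add: strict_mono_enumerate strict_mono_imp_inj_on)
    then have "card (S n) = Suc n"
      unfolding Sn by (simp add: card_image inj_on_subset)
    then have less: "n < card (S n)" by simp
    then have kn: "k n \<in> S n" using k fin by blast
    then have "k n \<in> X j"
      using Sn X[OF j] by (auto intro: enumerate_in_set)
    moreover have "g (k n) = f j (k n)"
      unfolding g_def N[OF less]
    proof (rule the_equality)
      show "(k n, f j (k n)) \<in> set (G n)"
        using kn unfolding S_def n[symmetric] F_def by auto
    next
      show "v = f j (k n)" if "(k n, v) \<in> set (G n)" for v
        using that unfolding n[symmetric] F_def by auto
    qed
    ultimately show "\<exists>m\<in>X j. f j m = g m" by metis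
  qed
qed

text \<open>Meeting \<open>f j\<close> beyond \<open>k\<close> is meeting it on the tail
  \<open>{k..}\<close>; one task for each pair of \<open>j\<close> and \<open>k\<close> still makes
  fewer than continuum many.\<close>

lemma guess_infinitely_often:
  fixes f :: "'i \<Rightarrow> nat \<Rightarrow> 'v::countable"
  assumes guessing "below_continuum J"
  obtains g where "\<And>j k. j \<in> J \<Longrightarrow> \<exists>n\<ge>k. f j n = g n"
proof -
  obtain g where g: "\<And>q. q \<in> J \<times> (UNIV :: nat set) \<Longrightarrow> \<exists>n\<in>{snd q..}. f (fst q) n = g n"
    using guess_on_infinite_sets[OF assms(1) below_continuum_Times_nat[OF assms(2)],
        of "\<lambda>q. {snd q..}" "\<lambda>q. f (fst q)"] infinite_Ici by blast
  show thesis
    using g by (intro that[of g]) fastforce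
qed

text \<open>Supplies bounds for the prediction below: at infinitely many stages the next bound
  leaves room for everything \<open>f j\<close> can produce from the present one.\<close>

lemma escaping_sequence:
  fixes f :: "'i \<Rightarrow> nat \<Rightarrow> nat"
  assumes guessing "below_continuum J" and mono: "\<And>j. j \<in> J \<Longrightarrow> mono (f j)"
  obtains g where "c \<le> g 0" "\<And>n. g n < g (Suc n)"
    "\<And>j. j \<in> J \<Longrightarrow> infinite {n. f j (g n) \<le> g (Suc n)}"
proof -
  \<comment> \<open>Iterating \<open>f j\<close> twice absorbs the index shift: if \<open>f j (f j (g n)) \<le> g (n + 2)\<close>, then
    \<open>n\<close> or \<open>n + 1\<close> is as desired.\<close>
  obtain h where h: "\<And>j k. j \<in> J \<Longrightarrow> \<exists>n\<ge>k. f j (f j n) = h n"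
    using guess_infinitely_often[OF assms(1,2), of "\<lambda>j n. f j (f j n)"] by blast
  define g where "g = rec_nat c (\<lambda>_ m. Suc (max m (Max (h ` {..m}))))"
  have g0: "g 0 = c" and gS: "g (Suc n) = Suc (max (g n) (Max (h ` {..g n})))" for n
    by (simp_all add: g_def)
  have less: "g n < g (Suc n)" for n by (simp add: gS)
  then have sm: "strict_mono g" by (simp add: strict_mono_Suc_iff)
  have hg: "h m \<le> g (Suc n)" if "m \<le> g n" for m n
  proof -
    have "h m \<le> Max (h ` {..g n})" using that by (intro Max_ge) auto
    then show ?thesis by (simp add: gS)
  qed
  show thesis
  proof
    fix j assume j: "j \<in> J"
    show "infinite {n. f j (g n) \<le> g (Suc n)}"
      unfolding infinite_nat_iff_unbounded_le
    proof
      fix k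
      obtain m where m: "m \<ge> Suc (g k)" "f j (f j m) = h m" using h[OF j] by blast
      \<comment> \<open>The first stage at which \<open>g\<close> reaches \<open>m\<close>, so
        \<open>g (n - 1) < m \<le> g n\<close>. The choice of \<open>m\<close> above
        \<open>g k\<close> forces \<open>k < n\<close>.\<close>
      define n where "n = (LEAST n. m \<le> g n)"
      have ex: "m \<le> g m" using sm by (rule strict_mono_imp_increasing)
      then have mn: "m \<le> g n" unfolding n_def by (rule LeastI)
      have "k < n"
        using m(1) mn strict_mono_less[OF sm] by (metis Suc_le_lessD less_le_trans)
      then obtain n' where n': "n = Suc n'" "k \<le> n'" by (cases n) auto
      then have "g n' < m"
        using not_less_Least[of n' "\<lambda>n. m \<le> g n"] n_def by auto
      show "\<exists>n\<ge>k. n \<in> {n. f j (g n) \<le> g (Suc n)}"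
      proof (cases "f j (g n') \<le> g n")
        case True
        with n' show ?thesis by blast
      next
        case False
        then have "f j (g n) \<le> f j (f j (g n'))"
          using mono[OF j] by (simp add: monoD)
        also have "\<dots> \<le> f j (f j m)"
          using mono[OF j] \<open>g n' < m\<close> by (simp add: monoD)
        also have "\<dots> \<le> g (Suc n)" using m(2) hg[OF mn] by simp
        finally show ?thesis using \<open>k < n\<close> by (intro exI[of _ n]) auto
      qed
    qed
  qed (use g0 less in auto)
qed

section \<open>Predicting moves along a path\<close>

text \<open>The position \<open>p n\<close> depends on earlier guesses, so no single value of
  \<open>\<phi> j\<close> can be guessed in advance. Instead the whole table of
  \<open>\<phi> j\<close> up to the bound \<open>g n\<close> is guessed, and only at stages where
  all its entries are at most \<open>g (Suc n)\<close>. Keeping \<open>p n \<le> g n\<close> ensures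
  that the table contains the entry needed.\<close>

lemma predict_nat:
  fixes \<phi> :: "'i \<Rightarrow> nat \<Rightarrow> nat"
  assumes guessing "below_continuum J"
    and refl: "\<And>q. R q q" and R: "\<And>j q. j \<in> J \<Longrightarrow> R q (\<phi> j q)"
  obtains p where "p 0 = q0" "\<And>n. R (p n) (p (Suc n))"
    "\<And>j. j \<in> J \<Longrightarrow> \<exists>n. p (Suc n) = \<phi> j (p n)"
proof -
  define f where "f j n = Max (\<phi> j ` {..n})" for j n
  have "mono (f j)" for j
    unfolding f_def by (intro monoI Max_mono) auto
  then obtain g where g: "q0 \<le> g 0" "\<And>n. g n < g (Suc n)"
    and inf: "\<And>j. j \<in> J \<Longrightarrow> infinite {n. f j (g n) \<le> g (Suc n)}"
    using escaping_sequence[OF assms(1,2), of f q0] by blast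
  obtain G where G: "\<And>j. j \<in> J \<Longrightarrow>
      \<exists>n\<in>{n. f j (g n) \<le> g (Suc n)}. map (\<phi> j) [0..<Suc (g n)] = G n"
    using guess_on_infinite_sets[OF assms(1,2),
        where X = "\<lambda>j. {n. f j (g n) \<le> g (Suc n)}"
          and f = "\<lambda>j n. map (\<phi> j) [0..<Suc (g n)]"] inf by blast
  \<comment> \<open>A guess is followed only if it respects both the bound and \<open>R\<close>;
    otherwise the path stands still, which reflexivity allows.\<close>
  define p where "p = rec_nat q0
    (\<lambda>n q. if G n ! q \<le> g (Suc n) \<and> R q (G n ! q) then G n ! q else q)"
  have p0: "p 0 = q0" and pS: "p (Suc n) =
     (if G n ! p n \<le> g (Suc n) \<and> R (p n) (G n ! p n) then G n ! p n else p n)" for n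
    by (simp_all add: p_def)
  have pg: "p n \<le> g n" for n
  proof (induction n)
    case 0
    show ?case using g(1) p0 by simp
  next
    case (Suc n)
    then show ?case using g(2)[of n] by (auto simp: pS)
  qed
  show thesis
  proof
    show "R (p n) (p (Suc n))" for n by (simp add: pS refl)
  next
    fix j assume j: "j \<in> J"
    then obtain n where n: "f j (g n) \<le> g (Suc n)" "map (\<phi> j) [0..<Suc (g n)] = G n"
      using G by blast
    have eq: "G n ! p n = \<phi> j (p n)"
      using pg[of n] unfolding n(2)[symmetric] by (simp del: upt_Suc)
    have "\<phi> j (p n) \<le> f j (g n)"
      unfolding f_def using pg[of n] by (intro Max_ge) auto
    then have "p (Suc n) = \<phi> j (p n)"
      using n(1) R[OF j] by (simp add: pS eq)
    then show "\<exists>n. p (Suc n) = \<phi> j (p n)" ..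
  qed (rule p0)
qed

lemma predict:
  fixes \<phi> :: "'i \<Rightarrow> 'q::countable \<Rightarrow> 'q"
  assumes guessing "below_continuum J"
    and refl: "\<And>q. R q q" and R: "\<And>j q. j \<in> J \<Longrightarrow> R q (\<phi> j q)"
  obtains p where "p 0 = q0" "\<And>n. R (p n) (p (Suc n))"
    "\<And>j. j \<in> J \<Longrightarrow> \<exists>n. p (Suc n) = \<phi> j (p n)"
proof -
  obtain p :: "nat \<Rightarrow> nat" where p: "p 0 = to_nat q0" "\<And>n. R (from_nat (p n)) (from_nat (p (Suc n)))"
    "\<And>j. j \<in> J \<Longrightarrow> \<exists>n. p (Suc n) = to_nat (\<phi> j (from_nat (p n)))"
    using predict_nat[OF assms(1,2), of "\<lambda>a b. R (from_nat a) (from_nat b)"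
        "\<lambda>j q. to_nat (\<phi> j (from_nat q))" "to_nat q0"] refl R by auto
  show thesis
  proof
    fix j assume "j \<in> J"
    then show "\<exists>n. from_nat (p (Suc n)) = \<phi> j (from_nat (p n))"
      using p(3) by (metis from_nat_to_nat)
  qed (use p in auto)
qed

subsection \<open>Diagonalising over uniformly continuous functions\<close>

text \<open>A countable code \<open>C\<close> lists the triples \<open>(\<sigma>, p, q)\<close> such that a partial function on
  sequences takes a value in \<open>(p, q)\<close> at some point with prefix \<open>\<sigma>\<close>. Then \<open>fibre C y\<close> is the
  section at \<open>y\<close> of the closure of its graph.\<close>
definition fibre :: "(nat list \<times> rat \<times> rat) set \<Rightarrow> real \<Rightarrow> (nat \<Rightarrow> nat) set" where
  "fibre C y = {x. \<forall>n p q. of_rat p < y \<and> y < of_rat q \<longrightarrow> (map x [0..<n], p, q) \<in> C}"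

text \<open>In other words, the coded closed relation is single-valued.\<close>

definition separated :: "(nat list \<times> rat \<times> rat) set \<Rightarrow> bool" where
  "separated C \<longleftrightarrow> (\<forall>y y'. y \<noteq> y' \<longrightarrow> fibre C y \<inter> fibre C y' = {})"

definition evading :: "nat list \<Rightarrow> (nat \<Rightarrow> nat) \<Rightarrow> (nat \<Rightarrow> nat) set" where
  "evading \<sigma> g = {x. map x [0..<length \<sigma>] = \<sigma> \<and> (\<forall>n\<ge>length \<sigma>. x n \<noteq> g n)}"

text \<open>Here \<open>g\<close> ranges over all sequences, so these values depend on
  \<open>C\<close> alone: a value chosen outside them at one stage of the recursion stays suitable
  for the \<open>g\<close> of every later stage.\<close>

definition thick_values :: "(nat list \<times> rat \<times> rat) set \<Rightarrow> real set" where
  "thick_values C = {y. \<exists>\<sigma> g. evading \<sigma> g \<subseteq> fibre C y}"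

lemma fibre_empty: "fibre {} y = {}"
  unfolding fibre_def
  using of_rat_dense[of "y - 1" y] of_rat_dense[of y "y + 1"] by force

lemma evading_Int_nonempty: "evading \<sigma> g \<inter> evading \<sigma> h \<noteq> {}"
proof -
  have "(\<lambda>n. if n < length \<sigma> then \<sigma> ! n else Suc (g n + h n)) \<in> evading \<sigma> g \<inter> evading \<sigma> h"
    by (auto simp: evading_def intro!: nth_equalityI)
  then show ?thesis by blast
qed

lemma countable_thick_values:
  assumes "separated C"
  shows "countable (thick_values C)"
proof -
  have "\<forall>y\<in>thick_values C. \<exists>\<sigma> g. evading \<sigma> g \<subseteq> fibre C y"
    by (simp add: thick_values_def)
  then obtain \<sigma> g where \<sigma>: "\<And>y. y \<in> thick_values C \<Longrightarrow> evading (\<sigma> y) (g y) \<subseteq> fibre C y"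
    unfolding bchoice_iff by blast
  have "inj_on \<sigma> (thick_values C)"
  proof (rule inj_onI, rule ccontr)
    fix y y' assume y: "y \<in> thick_values C" "y' \<in> thick_values C" "\<sigma> y = \<sigma> y'" "y \<noteq> y'"
    then have "fibre C y \<inter> fibre C y' = {}"
      using assms by (simp add: separated_def)
    then show False
      using \<sigma>[OF y(1)] \<sigma>[OF y(2)] evading_Int_nonempty[of "\<sigma> y" "g y" "g y'"] y(3) by auto
  qed
  then show ?thesis
    using countable_image_inj_on countableI_type by blast
qed

section \<open>Leaving fewer than continuum many fibres while evading a sequence\<close>

definition evading_extension :: "(nat \<Rightarrow> nat) \<Rightarrow> nat list \<Rightarrow> nat list \<Rightarrow> bool" where
  "evading_extension g \<sigma> \<tau> \<longleftrightarrow> length \<sigma> \<le> length \<tau> \<and> (\<forall>i<length \<sigma>. \<tau> ! i = \<sigma> ! i) \<and>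
     (\<forall>i. length \<sigma> \<le> i \<and> i < length \<tau> \<longrightarrow> \<tau> ! i \<noteq> g i)"

text \<open>Fibres are closed: a point of \<open>evading \<sigma> g\<close> outside the fibre is
  excluded from it by a finite prefix.\<close>

lemma evading_extension_off_fibre:
  assumes "y \<notin> thick_values C"
  shows "\<exists>\<tau>. evading_extension g \<sigma> \<tau> \<and> (\<forall>x. (\<forall>i<length \<tau>. x i = \<tau> ! i) \<longrightarrow> x \<notin> fibre C y)"
proof -
  obtain x where x: "x \<in> evading \<sigma> g" "x \<notin> fibre C y"
    using assms unfolding thick_values_def by blast
  then obtain n p q where C: "of_rat p < y" "y < of_rat q" "(map x [0..<n], p, q) \<notin> C"
    unfolding fibre_def by blast
  \<comment> \<open>The excluding prefix may be shorter than \<open>\<sigma>\<close>; the maximum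
    makes \<open>\<tau>\<close> extend \<open>\<sigma>\<close> in any case.\<close>
  define \<tau> where "\<tau> = map x [0..<max n (length \<sigma>)]"
  have eq: "x i = \<sigma> ! i" if "i < length \<sigma>" for i
  proof -
    have "map x [0..<length \<sigma>] ! i = \<sigma> ! i" using x(1) by (simp add: evading_def)
    then show ?thesis using that by simp
  qed
  have "evading_extension g \<sigma> \<tau>"
    using x(1) eq by (auto simp: evading_extension_def \<tau>_def evading_def)
  moreover have "z \<notin> fibre C y" if "\<forall>i<length \<tau>. z i = \<tau> ! i" for z
  proof -
    have "map z [0..<n] = map x [0..<n]" using that by (auto simp: \<tau>_def)
    then have "(map z [0..<n], p, q) \<notin> C" using C(3) by metis
    then show ?thesis using C(1,2) unfolding fibre_def by blast
  qed
  ultimately show ?thesis by blast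
qed

text \<open>A Baire category argument with prediction in place of countably many steps:
  \<open>\<phi> j\<close> extends a prefix so as to leave the \<open>j\<close>-th fibre, and one
  correctly predicted move per \<open>j\<close> suffices.\<close>

lemma evade_fibres:
  assumes guessing "below_continuum J" and y: "\<And>j. j \<in> J \<Longrightarrow> y j \<notin> thick_values (C j)"
  shows "\<exists>x. (\<forall>n. x n \<noteq> g n) \<and> (\<forall>j\<in>J. x \<notin> fibre (C j) (y j))"
proof -
  define \<phi> where "\<phi> j \<sigma> = (SOME \<tau>. evading_extension g \<sigma> \<tau> \<and>
      (\<forall>x. (\<forall>i<length \<tau>. x i = \<tau> ! i) \<longrightarrow> x \<notin> fibre (C j) (y j)))" for j \<sigma>
  have \<phi>: "evading_extension g \<sigma> (\<phi> j \<sigma>) \<and>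
      (\<forall>x. (\<forall>i<length (\<phi> j \<sigma>). x i = \<phi> j \<sigma> ! i) \<longrightarrow> x \<notin> fibre (C j) (y j))"
    if "j \<in> J" for j \<sigma>
    unfolding \<phi>_def by (rule someI_ex, rule evading_extension_off_fibre, rule y[OF that])
  obtain p where p0: "p 0 = []" and ext: "\<And>n. evading_extension g (p n) (p (Suc n))"
    and hit: "\<And>j. j \<in> J \<Longrightarrow> \<exists>n. p (Suc n) = \<phi> j (p n)"
    by (rule predict[OF assms(1,2), of "evading_extension g" \<phi> "[]"])
      (use \<phi> in \<open>auto simp: evading_extension_def\<close>)
  have ev: "p n ! i \<noteq> g i" if "i < length (p n)" for n i
    using that
  proof (induction n)
    case (Suc n)
    then show ?case using ext[of n] unfolding evading_extension_def
      by (cases "i < length (p n)") auto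
  qed (simp add: p0)
  have stable: "i < length (p (n + d)) \<and> p (n + d) ! i = p n ! i" if "i < length (p n)" for n d i
  proof (induction d)
    case (Suc d)
    then show ?case using ext[of "n + d"] unfolding evading_extension_def by auto
  qed (simp add: that)
  \<comment> \<open>The prefixes need not grow forever; coordinates that none of them reaches get a
    value different from \<open>g i\<close>.\<close>
  define x where "x i = (if \<exists>n. i < length (p n) then p (LEAST n. i < length (p n)) ! i else Suc (g i))" for i
  have x: "x i = p n ! i" if "i < length (p n)" for i n
  proof -
    define m where "m = (LEAST n. i < length (p n))"
    have "i < length (p m)" unfolding m_def using that by (rule LeastI)
    moreover have "m \<le> n" unfolding m_def using that by (rule Least_le)
    ultimately have "p n ! i = p m ! i"
      using stable[of i m "n - m"] by simp
    then show ?thesis using that unfolding x_def m_def by auto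
  qed
  have "x i \<noteq> g i" for i
  proof (cases "\<exists>n. i < length (p n)")
    case True
    then show ?thesis using ev x by metis
  qed (simp add: x_def)
  moreover have "x \<notin> fibre (C j) (y j)" if j: "j \<in> J" for j
  proof -
    obtain n where "p (Suc n) = \<phi> j (p n)" using hit[OF j] by blast
    then show ?thesis using \<phi>[OF j] x by metis
  qed
  ultimately show ?thesis by blast
qed

section \<open>The transfinite recursion\<close>

lemma exists_diagonal_set:
  assumes guessing
  obtains X :: "(nat \<Rightarrow> nat) set"
  where "\<And>g. \<exists>x\<in>X. \<forall>n. x n \<noteq> g n"
    and "\<And>C. separated C \<Longrightarrow> \<exists>y\<in>{0..1}. X \<inter> fibre C y = {}"
proof -
  \<comment> \<open>A cardinal well-order, so that every stage has fewer than continuum many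
    predecessors.\<close>
  define r where "r = card_of (UNIV :: real set)"
  have wo: "Well_order r" and F: "Field r = UNIV" and co: "Card_order r"
    unfolding r_def by (rule card_of_Well_order Field_card_of card_of_Card_order)+
  have wf: "wf (r - Id)"
    using wo by (simp add: well_order_on_def)
  have U: "below_continuum {j. (j, i) \<in> r - Id}" for i
  proof -
    have "underS r i = {j. (j, i) \<in> r - Id}" by (auto simp: underS_def)
    then show ?thesis
      using card_of_underS[OF co, of i] F unfolding below_continuum_iff_ordLess r_def by simp
  qed
  have tot: "(i, j) \<in> r - Id \<or> i = j \<or> (j, i) \<in> r - Id" for i j
    using wo F by (auto simp: well_order_on_def linear_order_on_def total_on_def)
  obtain c :: "real \<Rightarrow> (nat list \<times> rat \<times> rat) set" where c: "surj c"
    using sets_of_countable_lepoll_real[of UNIV] unfolding lepoll_iff by (metis top.extremum_unique)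
  obtain \<gamma> :: "real \<Rightarrow> nat \<Rightarrow> nat" where \<gamma>: "surj \<gamma>"
    using fun_nat_lepoll_real unfolding lepoll_iff by (metis top.extremum_unique)
  \<comment> \<open>A code that is not separated is replaced by the empty one, whose fibres are
    empty, so that all stages can be treated alike.\<close>
  define C where "C i = (if separated (c i) then c i else {})" for i
  have sep: "separated (C i)" for i
    by (simp add: C_def separated_def fibre_empty)
  \<comment> \<open>The value \<open>snd z\<close> is chosen against the earlier points, the point
    \<open>fst z\<close> against the values of this and all earlier stages. Hence no point lies in
    the chosen fibre of any stage, whichever comes first.\<close>
  define P where "P f i z \<longleftrightarrow> snd z \<in> {0..1} \<and> snd z \<notin> thick_values (C i) \<and>
      (\<forall>j. (j, i) \<in> r - Id \<longrightarrow> fst (f j) \<notin> fibre (C i) (snd z)) \<and>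
      (\<forall>n. fst z n \<noteq> \<gamma> i n) \<and>
      (\<forall>j. (j, i) \<in> r - Id \<longrightarrow> fst z \<notin> fibre (C j) (snd (f j))) \<and>
      fst z \<notin> fibre (C i) (snd z)"
    for f :: "real \<Rightarrow> (nat \<Rightarrow> nat) \<times> real" and i z
  have "\<exists>f. \<forall>i. P f i (f i)"
  proof (rule dependent_wf_choice[OF wf])
    fix f g :: "real \<Rightarrow> (nat \<Rightarrow> nat) \<times> real" and i z
    assume "\<And>j. (j, i) \<in> r - Id \<Longrightarrow> f j = g j"
    then show "P f i z = P g i z" unfolding P_def by (metis (no_types, lifting))
  next
    fix i and f :: "real \<Rightarrow> (nat \<Rightarrow> nat) \<times> real"
    assume IH: "\<And>j. (j, i) \<in> r - Id \<Longrightarrow> P f j (f j)"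
    let ?U = "{j. (j, i) \<in> r - Id}"
    \<comment> \<open>By separation each earlier point rules out at most one value. For a point in
      no fibre, \<open>THE\<close> only adds a harmless real.\<close>
    let ?B = "(\<lambda>j. THE y. fst (f j) \<in> fibre (C i) y) ` ?U"
    have B: "y \<in> ?B" if "j \<in> ?U" "fst (f j) \<in> fibre (C i) y" for j y
    proof -
      have "(THE y. fst (f j) \<in> fibre (C i) y) = y"
        using that(2) sep[of i] unfolding separated_def by (intro the_equality) blast+
      then show ?thesis using that(1) by blast
    qed
    have "below_continuum (thick_values (C i) \<union> ?B)"
      by (intro below_continuum_Un countable_below_continuum countable_thick_values sep
          below_continuum_image U)
    then have "\<not> {0..1} \<subseteq> thick_values (C i) \<union> ?B"
      using below_continuum_lepoll subset_imp_lepoll closed_interval_not_below_continuum[of 0 1]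
      by (metis zero_less_one)
    then obtain y where y: "y \<in> {0..1}" "y \<notin> thick_values (C i)" "y \<notin> ?B" by blast
    have "below_continuum (insert i ?U)"
      using below_continuum_Un[OF countable_below_continuum[of "{i}"] U] by simp
    moreover have "(if j = i then y else snd (f j)) \<notin> thick_values (C j)" if "j \<in> insert i ?U" for j
      using that y(2) IH unfolding P_def by auto
    ultimately obtain x where x: "\<forall>n. x n \<noteq> \<gamma> i n"
      "\<forall>j\<in>insert i ?U. x \<notin> fibre (C j) (if j = i then y else snd (f j))"
      using evade_fibres[OF assms, of "insert i ?U" "\<lambda>j. if j = i then y else snd (f j)" C "\<gamma> i"] by blast
    have "P f i (x, y)"
      unfolding P_def using x y B by (auto split: if_splits)
    then show "\<exists>z. P f i z" ..
  qed
  then obtain f where f: "\<And>i. P f i (f i)" by blast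
  show thesis
  proof
    fix g
    obtain i where "\<gamma> i = g" using \<gamma> by (metis surjD)
    then show "\<exists>x\<in>range (fst \<circ> f). \<forall>n. x n \<noteq> g n" using f[of i] unfolding P_def by auto
  next
    fix D :: "(nat list \<times> rat \<times> rat) set" assume D: "separated D"
    obtain i where "c i = D" using c by (metis surjD)
    with D have i: "C i = D" by (simp add: C_def)
    have "fst (f k) \<notin> fibre (C i) (snd (f i))" for k
      using tot[of k i] f[of i] f[of k] unfolding P_def by blast
    then show "\<exists>y\<in>{0..1}. range (fst \<circ> f) \<inter> fibre D y = {}"
      using i f[of i] unfolding P_def by (intro bexI[of _ "snd (f i)"]) auto
  qed
qed

section \<open>From omitted fibres to omitted values\<close>

text \<open>Stated with prefixes because the uniform structure of \<open>seq_dist s\<close> is the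
  same for every \<open>s > 0\<close>.\<close>

definition unif_cont_on_seqs :: "(nat \<Rightarrow> nat) set \<Rightarrow> ((nat \<Rightarrow> nat) \<Rightarrow> real) \<Rightarrow> bool" where
  "unif_cont_on_seqs X f \<longleftrightarrow>
     (\<forall>\<epsilon>>0. \<exists>n. \<forall>x\<in>X. \<forall>y\<in>X. (\<forall>i<n. x i = y i) \<longrightarrow> \<bar>f x - f y\<bar> < \<epsilon>)"

text \<open>After rescaling to the unit interval, the code of the function is separated. A point
  common to two fibres need not lie in \<open>X\<close>; uniform continuity gives a prefix length
  that works near such a point too.\<close>

lemma not_onto_interval_if_fibres_omitted:
  assumes X: "\<And>C. separated C \<Longrightarrow> \<exists>y\<in>{0..1}. X \<inter> fibre C y = {}"
    and f: "unif_cont_on_seqs X f" and "a < b"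
  shows "f ` X \<noteq> {a..b}"
proof
  assume onto: "f ` X = {a..b}"
  define h where "h x = (f x - a) / (b - a)" for x
  have h: "\<exists>n. \<forall>x\<in>X. \<forall>y\<in>X. (\<forall>i<n. x i = y i) \<longrightarrow> \<bar>h x - h y\<bar> < \<epsilon>" if "\<epsilon> > 0" for \<epsilon>
  proof -
    have "\<epsilon> * (b - a) > 0" using that \<open>a < b\<close> by simp
    then obtain n where n: "\<And>x y. x \<in> X \<Longrightarrow> y \<in> X \<Longrightarrow> (\<forall>i<n. x i = y i) \<Longrightarrow> \<bar>f x - f y\<bar> < \<epsilon> * (b - a)"
      using f unfolding unif_cont_on_seqs_def by meson
    have "h x - h y = (f x - f y) / (b - a)" for x y
      by (simp add: h_def diff_divide_distrib)
    then have "\<bar>h x - h y\<bar> = \<bar>f x - f y\<bar> / (b - a)" for x y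
      using \<open>a < b\<close> by (simp add: abs_divide)
    with n \<open>a < b\<close> show ?thesis by (intro exI[of _ n]) (simp add: divide_less_eq)
  qed
  define C where "C = {(\<sigma>, p, q). \<exists>z\<in>X. map z [0..<length \<sigma>] = \<sigma> \<and> of_rat p < h z \<and> h z < of_rat q}"
  have in_fibre: "x \<in> fibre C (h x)" if "x \<in> X" for x
    using that unfolding fibre_def C_def by auto
  have "separated C"
    unfolding separated_def
  proof (intro allI impI equals0I)
    fix y y' :: real and x assume "y \<noteq> y'" and x: "x \<in> fibre C y \<inter> fibre C y'"
    define \<epsilon> where "\<epsilon> = \<bar>y - y'\<bar> / 3"
    have "\<epsilon> > 0" using \<open>y \<noteq> y'\<close> by (simp add: \<epsilon>_def)
    then obtain n where n: "\<And>x y. x \<in> X \<Longrightarrow> y \<in> X \<Longrightarrow> (\<forall>i<n. x i = y i) \<Longrightarrow> \<bar>h x - h y\<bar> < \<epsilon>"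
      using h by meson
    have near: "\<exists>z\<in>X. (\<forall>i<n. z i = x i) \<and> \<bar>h z - v\<bar> < \<epsilon>" if v: "x \<in> fibre C v" for v
    proof -
      obtain p q where pq: "v - \<epsilon> < of_rat p" "of_rat p < v" "v < of_rat q" "of_rat q < v + \<epsilon>"
        using of_rat_dense[of "v - \<epsilon>" v] of_rat_dense[of v "v + \<epsilon>"] \<open>\<epsilon> > 0\<close> by auto
      then have "(map x [0..<n], p, q) \<in> C" using v unfolding fibre_def by blast
      then obtain z where z: "z \<in> X" "map z [0..<n] = map x [0..<n]" "of_rat p < h z" "h z < of_rat q"
        unfolding C_def by auto
      then show ?thesis using pq by (intro bexI[of _ z]) auto
    qed
    obtain z z' where "z \<in> X" "z' \<in> X" "\<forall>i<n. z i = x i" "\<forall>i<n. z' i = x i"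
      "\<bar>h z - y\<bar> < \<epsilon>" "\<bar>h z' - y'\<bar> < \<epsilon>"
      using near[of y] near[of y'] x by blast
    moreover from this have "\<bar>h z - h z'\<bar> < \<epsilon>" using n by simp
    moreover have "\<bar>y - y'\<bar> \<le> \<bar>h z - y\<bar> + \<bar>h z - h z'\<bar> + \<bar>h z' - y'\<bar>" by linarith
    moreover have "\<bar>y - y'\<bar> = 3 * \<epsilon>" by (simp add: \<epsilon>_def)
    ultimately show False by linarith
  qed
  then obtain y where y: "y \<in> {0..1}" "X \<inter> fibre C y = {}" using X by blast
  have "0 \<le> (b - a) * y" "(b - a) * y \<le> b - a"
    using y(1) \<open>a < b\<close> by (auto intro: mult_left_le)
  then have "a + (b - a) * y \<in> {a..b}" by simp
  then obtain x where "x \<in> X" "f x = a + (b - a) * y" using onto by (metis imageE)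
  then have "h x = y" using \<open>a < b\<close> by (simp add: h_def)
  with in_fibre \<open>x \<in> X\<close> y(2) show False by blast
qed

lemma exists_evading_set_not_onto_interval:
  obtains X :: "(nat \<Rightarrow> nat) set"
  where "\<And>g. \<exists>x\<in>X. \<forall>n. x n \<noteq> g n"
    and "\<And>f a b. unif_cont_on_seqs X f \<Longrightarrow> a < b \<Longrightarrow> f ` X \<noteq> {a..b}"
proof (cases guessing)
  case True
  then obtain X :: "(nat \<Rightarrow> nat) set" where X: "\<And>g. \<exists>x\<in>X. \<forall>n. x n \<noteq> g n"
    "\<And>C. separated C \<Longrightarrow> \<exists>y\<in>{0..1}. X \<inter> fibre C y = {}"
    by (rule exists_diagonal_set) blast
  show thesis
    by (rule that[OF X(1) not_onto_interval_if_fibres_omitted[OF X(2)]])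
next
  case False
  then obtain X :: "(nat \<Rightarrow> nat) set" where X: "below_continuum X" "\<And>g. \<exists>x\<in>X. \<forall>n. x n \<noteq> g n"
    unfolding guessing_def by blast
  show thesis
  proof (rule that[OF X(2)])
    show "f ` X \<noteq> {a..b}" if "a < b" for f and a b :: real
      using below_continuum_image[OF X(1), of f] closed_interval_not_below_continuum[OF that] by auto
  qed
qed

subsection \<open>The metric and its Hausdorff dimension\<close>

text \<open>The exponent makes the \<open>s\<close>-th power of the distance
  \<open>1 / (k + 1)\<close>, which is the bound that a rank of \<open>k\<close> puts on a term of a
  sum at most 1.\<close>

definition seq_dist :: "real \<Rightarrow> (nat \<Rightarrow> nat) \<Rightarrow> (nat \<Rightarrow> nat) \<Rightarrow> real" where
  "seq_dist s x y = (if x = y then 0 else (1 / real (Suc (LEAST k. x k \<noteq> y k))) powr (1 / s))"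

lemma seq_dist_less_iff:
  assumes "s > 0"
  shows "seq_dist s x y < (1 / real (Suc k)) powr (1 / s) \<longleftrightarrow> (\<forall>i\<le>k. x i = y i)"
proof (cases "x = y")
  case False
  define l where "l = (LEAST k. x k \<noteq> y k)"
  have l: "x l \<noteq> y l"
    unfolding l_def by (rule LeastI_ex) (use False in auto)
  have "x i = y i" if "i < l" for i
    using not_less_Least that unfolding l_def by blast
  with l have "(\<forall>i\<le>k. x i = y i) \<longleftrightarrow> k < l"
    by (metis le_less_trans linorder_not_less)
  moreover have "(1 / real (Suc l)) powr (1 / s) < (1 / real (Suc k)) powr (1 / s) \<longleftrightarrow> k < l"
  proof
    show "k < l" if "(1 / real (Suc l)) powr (1 / s) < (1 / real (Suc k)) powr (1 / s)"
    proof (rule ccontr)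
      assume "\<not> k < l"
      then have "(1 / real (Suc k)) powr (1 / s) \<le> (1 / real (Suc l)) powr (1 / s)"
        using assms by (intro powr_mono2) (auto simp: field_simps)
      with that show False by simp
    qed
  next
    show "(1 / real (Suc l)) powr (1 / s) < (1 / real (Suc k)) powr (1 / s)" if "k < l"
      using that assms by (intro powr_less_mono2) (auto simp: field_simps)
  qed
  ultimately show ?thesis using False unfolding seq_dist_def l_def by auto
qed (simp add: seq_dist_def)

lemma seq_dist_nonneg: "0 \<le> seq_dist s x y"
  by (simp add: seq_dist_def)

lemma seq_dist_ultrametric:
  assumes "s > 0"
  shows "seq_dist s x z \<le> max (seq_dist s x y) (seq_dist s y z)"
proof (cases "x = z")
  case False
  define k where "k = (LEAST k. x k \<noteq> z k)"
  have "x k \<noteq> z k"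
    unfolding k_def by (rule LeastI_ex) (use False in auto)
  then have "x k \<noteq> y k \<or> y k \<noteq> z k" by auto
  then have "\<not> seq_dist s x y < (1 / real (Suc k)) powr (1 / s) \<or>
             \<not> seq_dist s y z < (1 / real (Suc k)) powr (1 / s)"
    using seq_dist_less_iff[OF assms] by blast
  then show ?thesis using False by (auto simp: seq_dist_def[of s x z] k_def)
qed (simp add: seq_dist_def le_max_iff_disj)

lemma Metric_space_seq_dist:
  assumes "s > 0" "inj_on \<pi> M"
  shows "Metric_space M (\<lambda>a b. seq_dist s (\<pi> a) (\<pi> b))"
proof
  show "seq_dist s (\<pi> a) (\<pi> b) = seq_dist s (\<pi> b) (\<pi> a)" for a b
    by (auto simp: seq_dist_def eq_commute)
  show "seq_dist s (\<pi> a) (\<pi> b) = 0 \<longleftrightarrow> a = b" if "a \<in> M" "b \<in> M" for a b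
    using inj_on_eq_iff[OF assms(2) that] by (auto simp: seq_dist_def)
  show "seq_dist s (\<pi> a) (\<pi> c) \<le> seq_dist s (\<pi> a) (\<pi> b) + seq_dist s (\<pi> b) (\<pi> c)" for a b c
    using seq_dist_ultrametric[OF assms(1), of "\<pi> a" "\<pi> c" "\<pi> b"]
      seq_dist_nonneg[of s "\<pi> a" "\<pi> b"] seq_dist_nonneg[of s "\<pi> b" "\<pi> c"] by linarith
qed (rule seq_dist_nonneg)

lemma exists_radius_less:
  fixes s e :: real
  assumes "s > 0" "e > 0"
  obtains k where "(1 / real (Suc k)) powr (1 / s) < e"
proof -
  obtain k where "inverse (real (Suc k)) < e powr s"
    using reals_Archimedean[of "e powr s"] assms by auto
  then have "(1 / real (Suc k)) powr (1 / s) < (e powr s) powr (1 / s)"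
    using assms by (intro powr_less_mono2) (auto simp: inverse_eq_divide)
  with assms show thesis by (intro that[of k]) (simp add: powr_powr)
qed

lemma separable_space_seq_dist:
  assumes "s > 0" and dist: "\<And>a b. mdist m a b = seq_dist s (\<pi> a) (\<pi> b)"
  shows "separable_space (mtopology_of m)"
proof -
  interpret Metric_space "mspace m" "mdist m" by (rule Metric_space_mspace_mdist)
  let ?P = "\<lambda>\<sigma> a. a \<in> mspace m \<and> map (\<pi> a) [0..<length \<sigma>] = \<sigma>"
  \<comment> \<open>One point for each finite prefix that occurs in the space.\<close>
  define D where "D = (\<lambda>\<sigma>. SOME a. ?P \<sigma> a) ` {\<sigma>. \<exists>a. ?P \<sigma> a}"
  have "countable D" unfolding D_def by (intro countable_image countableI_type)
  moreover have "D \<subseteq> mspace m"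
    unfolding D_def using someI_ex[of "?P _"] by blast
  moreover have "mtopology closure_of D = mspace m"
  proof -
    have "\<exists>d\<in>D. d \<in> mball a e" if a: "a \<in> mspace m" and "e > 0" for a e
    proof -
      obtain k where k: "(1 / real (Suc k)) powr (1 / s) < e"
        using exists_radius_less \<open>s > 0\<close> \<open>e > 0\<close> by blast
      let ?\<sigma> = "map (\<pi> a) [0..<Suc k]"
      define d where "d = (SOME b. ?P ?\<sigma> b)"
      have "?P ?\<sigma> a" using a by simp
      then have d: "?P ?\<sigma> d" and "d \<in> D"
        unfolding d_def D_def by (rule someI, blast)
      then have "\<forall>i\<le>k. \<pi> a i = \<pi> d i"
        by (auto simp del: upt_Suc)
      then have "mdist m a d < e"
        using seq_dist_less_iff[OF \<open>s > 0\<close>, of "\<pi> a" "\<pi> d" k] k by (simp add: dist)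
      then show ?thesis using a d \<open>d \<in> D\<close> by auto
    qed
    then show ?thesis unfolding metric_closure_of by auto
  qed
  ultimately show ?thesis
    unfolding separable_space_def mtopology_of_def by (metis topspace_mtopology)
qed

section \<open>The lower bound for the dimension\<close>

text \<open>Rank the terms by decreasing size, ties by index. A term and all those before it are at
  least as large as that term and sum to at most 1; positivity makes the ranks finite.\<close>

lemma exists_injective_rank:
  fixes a :: "nat \<Rightarrow> real"
  assumes pos: "\<And>n. a n > 0" and sum: "\<And>A. finite A \<Longrightarrow> sum a A \<le> 1"
  obtains r where "inj r" "\<And>n. real (Suc (r n)) * a n \<le> 1"
proof -
  define L where "L n = {m. a n < a m \<or> a m = a n \<and> m < n}" for n
  have le: "real (card B) * a n \<le> 1" if "finite B" "B \<subseteq> insert n (L n)" for B n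
  proof -
    have "real (card B) * a n = (\<Sum>m\<in>B. a n)" by simp
    also have "\<dots> \<le> sum a B" using that(2) by (intro sum_mono) (auto simp: L_def)
    finally show ?thesis using sum[OF that(1)] by linarith
  qed
  have fin: "finite (L n)" for n
  proof (rule ccontr)
    assume inf: "infinite (L n)"
    obtain N :: nat where N: "1 < real N * a n"
      using reals_Archimedean3[OF pos] by blast
    obtain B where "finite B" "card B = N" "B \<subseteq> L n"
      using infinite_arbitrarily_large[OF inf] by blast
    then show False using le[of B n] N by auto
  qed
  have psub: "L n \<subset> L n'" if "n \<in> L n'" for n n'
    using that unfolding L_def by auto
  show thesis
  proof
    show "inj (\<lambda>n. card (L n))"
    proof (rule injI, rule ccontr)
      fix n n' assume eq: "card (L n) = card (L n')" and "n \<noteq> n'"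
      then have "n \<in> L n' \<or> n' \<in> L n" unfolding L_def by auto
      then show False
        using psub psubset_card_mono[OF fin] eq by (metis less_irrefl)
    qed
    show "real (Suc (card (L n))) * a n \<le> 1" for n
      using le[of "insert n (L n)" n] fin by (simp add: L_def)
  qed
qed

lemma mdist_le_mdiam:
  assumes "\<And>x y. x \<in> S \<Longrightarrow> y \<in> S \<Longrightarrow> mdist m x y \<le> B" "x \<in> S" "y \<in> S"
  shows "mdist m x y \<le> mdiam m S"
proof -
  have bdd: "bdd_above (mdist m u ` S)" if "u \<in> S" for u
    using assms(1) that by (intro bdd_aboveI2[of _ _ B]) auto
  have "mdist m x y \<le> (SUP v\<in>S. mdist m x v)"
    using assms bdd by (intro cSUP_upper) auto
  also have "\<dots> \<le> (SUP u\<in>S. SUP v\<in>S. mdist m u v)"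
  proof (rule cSUP_upper[OF assms(2)])
    show "bdd_above ((\<lambda>u. SUP v\<in>S. mdist m u v) ` S)"
      using assms by (intro bdd_aboveI2[of _ _ B] cSUP_least) auto
  qed
  finally show ?thesis using assms(2) by (auto simp: mdiam_def)
qed

lemma mdiam_nonneg:
  assumes "\<And>x y. x \<in> S \<Longrightarrow> y \<in> S \<Longrightarrow> mdist m x y \<le> B"
  shows "0 \<le> mdiam m S"
proof (cases "S = {}")
  case False
  then obtain x where "x \<in> S" by blast
  then show ?thesis
    using mdist_le_mdiam[OF assms, of S x x] mdist_nonneg[of m x x] by linarith
qed (simp add: mdiam_def)

lemma hausdorff_dim_ge_if_evading:
  assumes "s > 0" and dist: "\<And>a b. mdist m a b = seq_dist s (\<pi> a) (\<pi> b)"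
    and ev: "\<And>g. \<exists>a\<in>mspace m. \<forall>n. \<pi> a n \<noteq> g n"
  shows "ereal s \<le> hausdorff_dim m"
  unfolding hausdorff_dim_def
proof (rule Inf_greatest, clarify)
  fix t :: real assume t: "t > 0" "hausdorff_measure m t (mspace m) = 0"
  show "ereal s \<le> ereal t"
  proof (rule ccontr)
    assume "\<not> ereal s \<le> ereal t"
    then have "t < s" by simp
    have "hausdorff_pre m t 1 (mspace m) \<le> hausdorff_measure m t (mspace m)"
      unfolding hausdorff_measure_def by (intro SUP_upper) auto
    also have "\<dots> < ennreal (1 / 2)"
      unfolding t(2) ennreal_less_zero_iff by simp
    finally obtain U where U: "mspace m \<subseteq> (\<Union>n. U n)"
      "\<And>n x y. x \<in> U n \<Longrightarrow> y \<in> U n \<Longrightarrow> mdist m x y \<le> 1"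
      "(\<Sum>n. ennreal (mdiam m (U n) powr t)) < ennreal (1 / 2)"
      unfolding hausdorff_pre_def INF_less_iff by blast
    \<comment> \<open>The summand \<open>(1 / 2) ^ (n + 2)\<close> keeps the ranks finite when some diameters vanish.\<close>
    define a where "a n = mdiam m (U n) powr t + (1 / 2) ^ (n + 2)" for n
    have "sum a A \<le> 1" if "finite A" for A
    proof -
      have "ennreal (\<Sum>n\<in>A. mdiam m (U n) powr t) = (\<Sum>n\<in>A. ennreal (mdiam m (U n) powr t))"
        by (simp add: sum_ennreal)
      also have "\<dots> \<le> (\<Sum>n. ennreal (mdiam m (U n) powr t))"
        using that by (intro sum_le_suminf) auto
      finally have "ennreal (\<Sum>n\<in>A. mdiam m (U n) powr t) < ennreal (1 / 2)"
        using U(3) by (rule le_less_trans)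
      then have 1: "(\<Sum>n\<in>A. mdiam m (U n) powr t) < 1 / 2"
        by (subst (asm) ennreal_less_iff) (auto intro: sum_nonneg)
      have half: "(\<lambda>n. (1 / 2 :: real) ^ n * (1 / 4)) sums (2 * (1 / 4))"
        using geometric_sums[of "1 / 2 :: real"] by (intro sums_mult2) simp
      then have "(\<Sum>n\<in>A. (1 / 2 :: real) ^ n * (1 / 4)) \<le> (\<Sum>n. (1 / 2) ^ n * (1 / 4))"
        using that by (intro sum_le_suminf) (auto simp: sums_iff)
      then have 2: "(\<Sum>n\<in>A. (1 / 2 :: real) ^ (n + 2)) \<le> 1 / 2"
        using sums_unique[OF half] by (simp add: power_add power2_eq_square)
      show ?thesis using 1 2 unfolding a_def sum.distrib by linarith
    qed
    moreover have "a n > 0" for n by (simp add: a_def add_nonneg_pos)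
    ultimately obtain r where r: "inj r" "\<And>n. real (Suc (r n)) * a n \<le> 1"
      using exists_injective_rank[of a] by blast
    \<comment> \<open>If \<open>k\<close> is the rank of a nonempty set, \<open>g k\<close> is the
      \<open>k\<close>-th coordinate of some point in it, soon seen to be common to all its points.
      Other values of \<open>g\<close> do not matter.\<close>
    define g where "g k = \<pi> (SOME z. z \<in> U (inv r k)) k" for k
    obtain x where x: "x \<in> mspace m" "\<And>n. \<pi> x n \<noteq> g n" using ev[of g] by blast
    then obtain n where n: "x \<in> U n" using U(1) by blast
    define z where "z = (SOME z. z \<in> U n)"
    have z: "z \<in> U n" unfolding z_def using n by (rule someI)
    have diam: "0 \<le> mdiam m (U n)" by (rule mdiam_nonneg[OF U(2)])
    \<comment> \<open>The extra summand also makes this strict, as needed for agreement at the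
      coordinate \<open>r n\<close> itself.\<close>
    have "mdiam m (U n) powr t < a n" by (simp add: a_def)
    also have "a n \<le> 1 / real (Suc (r n))"
      using r(2)[of n] by (simp add: field_simps)
    finally have "(mdiam m (U n) powr t) powr (1 / t) < (1 / real (Suc (r n))) powr (1 / t)"
      using t(1) by (intro powr_less_mono2) auto
    then have "mdiam m (U n) < (1 / real (Suc (r n))) powr (1 / t)"
      using t(1) diam by (simp add: powr_powr)
    \<comment> \<open>The base is at most 1, so the smaller exponent \<open>1 / s\<close> gives the
      larger power.\<close>
    also have "\<dots> \<le> (1 / real (Suc (r n))) powr (1 / s)"
      using \<open>t < s\<close> t(1) by (intro powr_mono') (auto simp: field_simps)
    finally have "mdiam m (U n) < (1 / real (Suc (r n))) powr (1 / s)" .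
    moreover have "mdist m x z \<le> mdiam m (U n)"
      by (rule mdist_le_mdiam[OF _ n z]) (rule U(2))
    ultimately have "seq_dist s (\<pi> x) (\<pi> z) < (1 / real (Suc (r n))) powr (1 / s)"
      by (simp add: dist)
    then have "\<pi> x (r n) = \<pi> z (r n)"
      using seq_dist_less_iff[OF \<open>s > 0\<close>] by blast
    also have "\<dots> = g (r n)" using r(1) by (simp add: g_def z_def)
    finally show False using x(2) by blast
  qed
qed

section \<open>Transfer to a metric on a set of reals\<close>

lemma unif_cont_on_seqs_of_uniformly_continuous_map:
  assumes "s > 0" and dist: "\<And>a b. mdist m a b = seq_dist s (\<pi> a) (\<pi> b)"
    and f: "uniformly_continuous_map m euclidean_metric f"
    and \<iota>: "\<And>x. x \<in> X \<Longrightarrow> \<iota> x \<in> mspace m \<and> \<pi> (\<iota> x) = x"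
  shows "unif_cont_on_seqs X (f \<circ> \<iota>)"
  unfolding unif_cont_on_seqs_def
proof (intro allI impI)
  fix e :: real assume "e > 0"
  then obtain d where d: "d > 0"
    "\<And>a b. a \<in> mspace m \<Longrightarrow> b \<in> mspace m \<Longrightarrow> mdist m b a < d \<Longrightarrow> \<bar>f b - f a\<bar> < e"
    using f unfolding uniformly_continuous_map_def by (auto simp: dist_real_def)
  obtain k where k: "(1 / real (Suc k)) powr (1 / s) < d"
    using exists_radius_less[OF \<open>s > 0\<close> d(1)] by blast
  have "\<bar>f (\<iota> x) - f (\<iota> y)\<bar> < e" if "x \<in> X" "y \<in> X" "\<forall>i<Suc k. x i = y i" for x y
  proof (rule d(2))
    have "seq_dist s x y < (1 / real (Suc k)) powr (1 / s)"
      using that(3) seq_dist_less_iff[OF \<open>s > 0\<close>] by (simp add: less_Suc_eq_le)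
    then show "mdist m (\<iota> x) (\<iota> y) < d" using k that \<iota> by (simp add: dist)
  qed (use that \<iota> in auto)
  then show "\<exists>n. \<forall>x\<in>X. \<forall>y\<in>X. (\<forall>i<n. x i = y i) \<longrightarrow> \<bar>(f \<circ> \<iota>) x - (f \<circ> \<iota>) y\<bar> < e"
    unfolding comp_def by blast
qed

theorem theorem3p1:
  fixes s :: real
  assumes "s > 0"
  shows "\<exists>X :: real metric.
           separable_space (mtopology_of X) \<and>
           hausdorff_dim X \<ge> ereal s \<and>
           \<not> (\<exists>(f :: real \<Rightarrow> real) (a :: real) b. a < b \<and> uniformly_continuous_map X euclidean_metric f \<and>
                     f ` mspace X = {a..b})"
proof -
  obtain X :: "(nat \<Rightarrow> nat) set" where ev: "\<And>g. \<exists>x\<in>X. \<forall>n. x n \<noteq> g n"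
    and X: "\<And>f a b. unif_cont_on_seqs X f \<Longrightarrow> a < b \<Longrightarrow> f ` X \<noteq> {a..b}"
    by (rule exists_evading_set_not_onto_interval) blast
  \<comment> \<open>There are at most continuum many sequences, so the space can be carried by a set
    of reals, with distances computed on the preimages.\<close>
  obtain \<iota> :: "(nat \<Rightarrow> nat) \<Rightarrow> real" where \<iota>: "inj \<iota>"
    using fun_nat_lepoll_real unfolding lepoll_def by blast
  let ?d = "\<lambda>a b. seq_dist s (inv \<iota> a) (inv \<iota> b)"
  interpret Metric_space "\<iota> ` X" ?d
    using assms \<iota> by (intro Metric_space_seq_dist inj_on_inv_into) auto
  let ?m = "metric (\<iota> ` X, ?d)"
  have dist: "mdist ?m a b = seq_dist s (inv \<iota> a) (inv \<iota> b)" for a b by simp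
  show ?thesis
  proof (intro exI conjI notI)
    show "separable_space (mtopology_of ?m)"
      using assms dist by (rule separable_space_seq_dist)
    show "ereal s \<le> hausdorff_dim ?m"
      using assms dist by (rule hausdorff_dim_ge_if_evading) (use ev \<iota> in auto)
    assume "\<exists>(f :: real \<Rightarrow> real) (a :: real) b. a < b \<and>
        uniformly_continuous_map ?m euclidean_metric f \<and> f ` mspace ?m = {a..b}"
    then obtain f :: "real \<Rightarrow> real" and a b :: real where f: "a < b" "uniformly_continuous_map ?m euclidean_metric f"
      "f ` mspace ?m = {a..b}" by blast
    have "unif_cont_on_seqs X (f \<circ> \<iota>)"
      using assms dist f(2) by (rule unif_cont_on_seqs_of_uniformly_continuous_map) (use \<iota> in auto)
    then have "(f \<circ> \<iota>) ` X \<noteq> {a..b}" using f(1) by (rule X)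
    then show False using f(3) by (simp add: image_comp)
  qed
qed

end
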